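(* Let $G$ be a simple graph on $n$ vertices ($n$ finite), with independence number $\alpha(G)$, Thue chromatic number $\pi(G)$ and Thue choice number $\pi_{ch}(G)$. Then: 1. $\pi(G)\leq \pi_{ch}(G)\leq n-\alpha(G)+1$. 2. If $G$ is a complete multipartite graph, then $\pi(G)=\pi_{ch}(G)=n-\alpha(G)+1$.
   Context: A repetition is a sequence $r_1\ldots r_{2n}$ with $n\ge 1$ and $r_i=r_{n+i}$ for all $1\le i\le n$. A vertex colouring $\varphi$ of a simple graph $G$ is non-repetitive if for every $n\ge 1$ and every simple path (distinct vertices, consecutive ones adjacent) $v_1\ldots v_{2n}$ in $G$, the colour sequence $\varphi(v_1)\ldots\varphi(v_{2n})$ is not a repetition (the case $n=1$ says that $\varphi$ is a proper colouring). The Thue chromatic number $\pi(G)$ is the minimum number of colours in a non-repetitive colouring of $G$. The Thue choice number $\pi_{ch}(G)$ is the smallest integer $k$ such that for every list assignment $L:V(G)\to 2^{\mathbb{N}}$ with $|L(v)|\ge k$ for all $v$, there is a non-repetitive colouring $\varphi$ of $G$ with $\varphi(v)\in L(v)$ for all $v\in V(G)$. A complete multipartite graph $K_{n_1,\ldots,n_k}$ ($k\ge 1$, all $n_i\ge 1$) has vertex set partitioned into sets $V_1,\ldots,V_k$ with $|V_i|=n_i$, two vertices being adjacent iff they lie in different partite sets. *)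

theory Defs
  imports "Graph_Theory.Graph_Theory" "HOL-Library.Disjoint_Sets"
begin

definition repetition :: "'c list \<Rightarrow> bool" where
  "repetition r \<longleftrightarrow> (\<exists>n\<ge>1. length r = 2 * n \<and> (\<forall>i<n. r ! i = r ! (n + i)))"

(* Simple graphs are the library's finite, loop-free, symmetric digraphs without
   parallel arcs (locale graph); vpath p G says that the vertex list p is a nonempty
   simple path of G. Only the values of a colouring on the vertices of G matter. *)

definition nonrepetitive :: "('a,'b) pre_digraph \<Rightarrow> ('a \<Rightarrow> 'c) \<Rightarrow> bool" where
  "nonrepetitive G \<phi> \<longleftrightarrow> (\<forall>p. vpath p G \<longrightarrow> \<not> repetition (map \<phi> p))"

definition thue_chromatic_number :: "('a,'b) pre_digraph \<Rightarrow> nat" where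
  "thue_chromatic_number G =
     (LEAST k. \<exists>\<phi> :: 'a \<Rightarrow> nat. nonrepetitive G \<phi> \<and> card (\<phi> ` verts G) = k)"

(* Lists are arbitrary sets of naturals. An infinite list has more than k elements,
   but its card is 0, hence the first disjunct. *)

definition thue_choosable :: "('a,'b) pre_digraph \<Rightarrow> nat \<Rightarrow> bool" where
  "thue_choosable G k \<longleftrightarrow>
     (\<forall>L :: 'a \<Rightarrow> nat set. (\<forall>v \<in> verts G. infinite (L v) \<or> k \<le> card (L v)) \<longrightarrow>
        (\<exists>\<phi>. nonrepetitive G \<phi> \<and> (\<forall>v \<in> verts G. \<phi> v \<in> L v)))"

definition thue_choice_number :: "('a,'b) pre_digraph \<Rightarrow> nat" where
  "thue_choice_number G = (LEAST k. thue_choosable G k)"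

definition independent_set :: "('a,'b) pre_digraph \<Rightarrow> 'a set \<Rightarrow> bool" where
  "independent_set G S \<longleftrightarrow> S \<subseteq> verts G \<and> (\<forall>u \<in> S. \<forall>v \<in> S. \<not> u \<rightarrow>\<^bsub>G\<^esub> v)"

definition independence_number :: "('a,'b) pre_digraph \<Rightarrow> nat" where
  "independence_number G = Max (card ` {S. independent_set G S})"

(* P is the set of partite sets; partition_on makes each of them nonempty. *)

definition complete_multipartite :: "('a,'b) pre_digraph \<Rightarrow> bool" where
  "complete_multipartite G \<longleftrightarrow> graph G \<and>
     (\<exists>P. P \<noteq> {} \<and> partition_on (verts G) P \<and>
        (\<forall>u \<in> verts G. \<forall>v \<in> verts G. u \<rightarrow>\<^bsub>G\<^esub> v \<longleftrightarrow> \<not> (\<exists>V \<in> P. u \<in> V \<and> v \<in> V)))"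

end

theory Submission
  imports Defs
begin

text \<open>
  Upper bound: fix a maximum independent set \<open>S\<close>. Lists of size \<open>n - \<alpha> + 1\<close> allow pairwise
  distinct colours on the \<open>n - \<alpha>\<close> vertices outside \<open>S\<close>, and colours on \<open>S\<close> that avoid all of
  those. In a repetitive path every colour occurs twice, so such a path would lie inside \<open>S\<close>,
  which has no edges. Lower bound for complete multipartite graphs: two vertices of the same
  colour lie in the same part; if two parts contained such pairs \<open>a, a'\<close> and \<open>b, b'\<close>, then the path
  \<open>a b a' b'\<close> would be repetitive. Hence some part \<open>V\<close> has all colours outside it distinct, and
  the colours on \<open>V\<close> do not occur outside \<open>V\<close>, so at least \<open>n - |V| + 1\<close> colours are used.
\<close>

section \<open>Choosing values from large sets\<close>

lemma exists_fresh_element: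
  assumes "finite X" and "infinite A \<or> card X < card A"
  shows "\<exists>a\<in>A. a \<notin> X"
proof (rule ccontr)
  assume "\<not> (\<exists>a\<in>A. a \<notin> X)"
  then have "A \<subseteq> X" by blast
  then show False
    using assms card_mono[of X A] finite_subset[of A X] by auto
qed

text \<open>Greedy choice: the elements handled earlier block at most \<open>card T - 1\<close>
  values, so a list that is infinite or has at least \<open>card T\<close> elements still offers a
  free one.\<close>

lemma exists_injective_selection:
  assumes "finite T" and "\<And>v. v \<in> T \<Longrightarrow> infinite (L v) \<or> card T \<le> card (L v)"
  shows "\<exists>f. inj_on f T \<and> (\<forall>v\<in>T. f v \<in> L v)"
  using assms
proof (induction T rule: finite_induct)
  case empty
  then show ?case by simp
next
  case (insert x F)
  have "infinite (L v) \<or> card F \<le> card (L v)" if "v \<in> F" for v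
    using insert.prems[of v] insert.hyps that by auto
  then obtain f where f: "inj_on f F" "\<forall>v\<in>F. f v \<in> L v"
    using insert.IH by blast
  have "card (f ` F) \<le> card F"
    using insert.hyps by (simp add: card_image_le)
  then have "infinite (L x) \<or> card (f ` F) < card (L x)"
    using insert.prems[of x] insert.hyps by auto
  then obtain a where a: "a \<in> L x" "a \<notin> f ` F"
    using exists_fresh_element[of "f ` F" "L x"] insert.hyps by auto
  have "inj_on (f(x := a)) (insert x F)"
    using f(1) a(2) insert.hyps(2) by (auto simp: inj_on_def)
  moreover have "\<forall>v\<in>insert x F. (f(x := a)) v \<in> L v"
    using f(2) a(1) by auto
  ultimately show ?case by blast
qed

section \<open>Repetitive paths and how a colouring excludes them\<close>

lemma repetition_map_recurs:
  assumes "repetition (map \<phi> p)" and "distinct p" and "u \<in> set p"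
  shows "\<exists>v\<in>set p. v \<noteq> u \<and> \<phi> v = \<phi> u"
proof -
  obtain n where n: "n \<ge> 1" "length p = 2 * n" "\<And>i. i < n \<Longrightarrow> \<phi> (p ! i) = \<phi> (p ! (n + i))"
    using assms(1) unfolding repetition_def by auto
  obtain j where j: "j < 2 * n" "u = p ! j"
    using assms(3) n(2) by (metis in_set_conv_nth)
  \<comment> \<open>The partner of position \<open>j\<close> in the other half of the path, reached
    by a shift of \<open>n\<close> forwards or backwards.\<close>
  define k where "k = (if j < n then n + j else j - n)"
  have "k < length p" "k \<noteq> j" "\<phi> (p ! k) = \<phi> (p ! j)"
    using n j(1) n(3)[of j] n(3)[of "j - n"] by (auto simp: k_def)
  then show ?thesis
    using j n(2) assms(2) by (metis nth_eq_iff_index_eq nth_mem)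
qed

lemma nonrepetitive_if_rainbow_off_independent:
  assumes "independent_set G S" and "inj_on \<phi> (verts G - S)"
    and disj: "\<And>u v. u \<in> S \<Longrightarrow> v \<in> verts G - S \<Longrightarrow> \<phi> u \<noteq> \<phi> v"
  shows "nonrepetitive G \<phi>"
  unfolding nonrepetitive_def
proof (intro allI impI notI)
  fix p assume p: "vpath p G" and rep: "repetition (map \<phi> p)"
  have dist: "distinct p" and sub: "set p \<subseteq> verts G"
    and arcs: "set (vwalk_arcs p) \<subseteq> arcs_ends G"
    using p by (auto simp: vpath_def vwalk_def)
  \<comment> \<open>A vertex outside \<open>S\<close> shares its colour with no other vertex:
    injectivity excludes those outside \<open>S\<close>, and \<open>disj\<close> excludes those in
    \<open>S\<close>.\<close>
  have in_S: "u \<in> S" if u: "u \<in> set p" for u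
  proof (rule ccontr)
    assume "u \<notin> S"
    obtain v where "v \<in> set p" "v \<noteq> u" "\<phi> v = \<phi> u"
      using repetition_map_recurs[OF rep dist u] by blast
    then show False
      using \<open>u \<notin> S\<close> u sub assms(2) disj[of v u] by (auto dest: inj_onD)
  qed
  \<comment> \<open>A repetition has length at least 2, so the path has a first arc. Both its ends
    lie in \<open>S\<close>, which contradicts independence.\<close>
  obtain x y xs where "p = x # y # xs"
  proof -
    have "length p \<ge> 2" using rep by (auto simp: repetition_def)
    then show thesis using that by (cases p rule: vwalk_arcs.cases) auto
  qed
  then show False
    using arcs in_S assms(1) by (auto simp: independent_set_def)
qed

lemma nonrepetitive_adjacent:
  assumes "loopfree_digraph G" and "nonrepetitive G \<phi>" and "u \<rightarrow>\<^bsub>G\<^esub> v"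
  shows "\<phi> u \<noteq> \<phi> v"
proof
  assume "\<phi> u = \<phi> v"
  interpret loopfree_digraph G by fact
  have "vpath [u, v] G"
    using assms(3) adj_not_same adj_in_verts by (auto simp: vpath_def vwalk_def)
  moreover have "repetition (map \<phi> [u, v])"
    using \<open>\<phi> u = \<phi> v\<close> unfolding repetition_def by (intro exI[of _ 1]) auto
  ultimately show False using assms(2) by (auto simp: nonrepetitive_def)
qed

section \<open>Maximum independent sets\<close>

lemma finite_independent_sets:
  assumes "finite (verts G)"
  shows "finite {S. independent_set G S}"
  by (rule finite_subset[of _ "Pow (verts G)"]) (use assms in \<open>auto simp: independent_set_def\<close>)

lemma card_le_independence_number:
  assumes "finite (verts G)" and "independent_set G S"
  shows "card S \<le> independence_number G"
  unfolding independence_number_def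
  using assms finite_independent_sets[OF assms(1)] by (intro Max_ge) auto

lemma obtain_maximum_independent_set:
  assumes "finite (verts G)"
  obtains S where "independent_set G S" and "card S = independence_number G"
proof -
  \<comment> \<open>The empty set makes the family nonempty, so its \<open>Max\<close> is
    attained.\<close>
  have "independent_set G {}" by (simp add: independent_set_def)
  then have "independence_number G \<in> card ` {S. independent_set G S}"
    unfolding independence_number_def
    using finite_independent_sets[OF assms] by (intro Max_in) auto
  then show thesis using that by auto
qed

section \<open>Upper bound through list colourings\<close>

lemma thue_choosable_independence_number:
  assumes fin: "finite (verts G)"
  shows "thue_choosable G (card (verts G) - independence_number G + 1)"
  unfolding thue_choosable_def
proof (intro allI impI)
  fix L :: "'a \<Rightarrow> nat set"
  assume L: "\<forall>v\<in>verts G. infinite (L v) \<or> card (verts G) - independence_number G + 1 \<le> card (L v)"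
  obtain S where S: "independent_set G S" "card S = independence_number G"
    using obtain_maximum_independent_set[OF fin] .
  define T where "T = verts G - S"
  have SV: "S \<subseteq> verts G" using S(1) by (simp add: independent_set_def)
  have finT: "finite T" using fin by (simp add: T_def)
  have "card T = card (verts G) - independence_number G"
    using SV S(2) fin by (simp add: T_def card_Diff_subset finite_subset)
  then have L': "infinite (L v) \<or> card T < card (L v)" if "v \<in> verts G" for v
    using L that by auto
  then have "infinite (L v) \<or> card T \<le> card (L v)" if "v \<in> T" for v
    using that by (auto simp: T_def intro: less_imp_le)
  then obtain f where f: "inj_on f T" "\<forall>v\<in>T. f v \<in> L v"
    using exists_injective_selection[OF finT] by blast
  \<comment> \<open>This is what the summand 1 in the list size pays for: removing the
    \<open>card T\<close> colours used on \<open>T\<close> still leaves a colour in each list.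
    Vertices of \<open>S\<close> may share colours.\<close>
  have "\<exists>a\<in>L v. a \<notin> f ` T" if "v \<in> verts G" for v
    using L'[OF that] card_image[OF f(1)] finT by (intro exists_fresh_element) auto
  then obtain g where g: "\<And>v. v \<in> verts G \<Longrightarrow> g v \<in> L v \<and> g v \<notin> f ` T"
    by metis
  define \<phi> where "\<phi> v = (if v \<in> T then f v else g v)" for v
  have "nonrepetitive G \<phi>"
  proof (rule nonrepetitive_if_rainbow_off_independent[OF S(1)])
    show "inj_on \<phi> (verts G - S)"
      using f(1) by (auto simp: \<phi>_def T_def inj_on_def)
    show "\<phi> u \<noteq> \<phi> v" if "u \<in> S" "v \<in> verts G - S" for u v
      using that g[of u] SV by (auto simp: \<phi>_def T_def)
  qed
  moreover have "\<forall>v\<in>verts G. \<phi> v \<in> L v"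
    using f(2) g by (auto simp: \<phi>_def)
  ultimately show "\<exists>\<phi>. nonrepetitive G \<phi> \<and> (\<forall>v\<in>verts G. \<phi> v \<in> L v)" by blast
qed

lemma thue_choice_number_le:
  "thue_choosable G k \<Longrightarrow> thue_choice_number G \<le> k"
  unfolding thue_choice_number_def by (rule Least_le)

text \<open>Giving every vertex the same list \<open>{..<k}\<close> turns a choice from lists into a
  colouring with at most \<open>k\<close> colours.\<close>

lemma thue_chromatic_number_le_if_choosable:
  assumes "thue_choosable G k"
  shows "thue_chromatic_number G \<le> k"
proof -
  obtain \<phi> :: "'a \<Rightarrow> nat" where \<phi>: "nonrepetitive G \<phi>" "\<forall>v\<in>verts G. \<phi> v \<in> {..<k}"
    using assms unfolding thue_choosable_def
    by (elim allE[of _ "\<lambda>_. {..<k}"]) auto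
  have "thue_chromatic_number G \<le> card (\<phi> ` verts G)"
    unfolding thue_chromatic_number_def using \<phi>(1) by (intro Least_le) blast
  also have "\<dots> \<le> card {..<k}"
    using \<phi>(2) by (intro card_mono) auto
  finally show ?thesis by simp
qed

lemma thue_chromatic_le_choice_number:
  assumes "finite (verts G)"
  shows "thue_chromatic_number G \<le> thue_choice_number G"
proof (rule thue_chromatic_number_le_if_choosable)
  \<comment> \<open>\<open>LEAST\<close> yields a choosable number only if there is one; the upper
    bound provides it.\<close>
  show "thue_choosable G (thue_choice_number G)"
    unfolding thue_choice_number_def
    using thue_choosable_independence_number[OF assms] by (rule LeastI)
qed

lemma obtain_optimal_nonrepetitive:
  assumes "finite (verts G)"
  obtains \<phi> :: "'a \<Rightarrow> nat"
  where "nonrepetitive (G :: ('a,'b) pre_digraph) \<phi>" and "card (\<phi> ` verts G) = thue_chromatic_number G"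
proof -
  \<comment> \<open>The list \<open>UNIV\<close> is infinite and so meets any size requirement;
    choosability then gives some nonrepetitive colouring.\<close>
  have "\<exists>\<phi> :: 'a \<Rightarrow> nat. nonrepetitive G \<phi>"
    using thue_choosable_independence_number[OF assms] unfolding thue_choosable_def
    by (elim allE[of _ "\<lambda>_. UNIV"]) auto
  then have "\<exists>k. \<exists>\<phi> :: 'a \<Rightarrow> nat. nonrepetitive G \<phi> \<and> card (\<phi> ` verts G) = k" by blast
  then have "\<exists>\<phi> :: 'a \<Rightarrow> nat. nonrepetitive G \<phi> \<and> card (\<phi> ` verts G) = thue_chromatic_number G"
    unfolding thue_chromatic_number_def
    by (rule LeastI_ex)
  then show thesis using that by blast
qed

section \<open>Lower bound for complete multipartite graphs\<close>

lemma nonrepetitive_no_crossing_pairs: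
  assumes "graph G" and nonrep: "nonrepetitive G \<phi>"
    and "a \<noteq> a'" and "b \<noteq> b'" and "\<phi> a = \<phi> a'" and "\<phi> b = \<phi> b'"
    and adj: "a \<rightarrow>\<^bsub>G\<^esub> b" "b \<rightarrow>\<^bsub>G\<^esub> a'" "a' \<rightarrow>\<^bsub>G\<^esub> b'"
  shows False
proof -
  interpret graph G by fact
  note neq = nonrepetitive_adjacent[OF loopfree_digraph_axioms nonrep]
  \<comment> \<open>Properness separates consecutive vertices. The ends differ too:
    \<open>b'\<close> has the colour of \<open>b\<close>, which is not that of
    \<open>a\<close>.\<close>
  have "distinct [a, b, a', b']"
    using assms neq[OF adj(1)] neq[OF adj(2)] neq[OF adj(3)] by auto
  then have "vpath [a, b, a', b'] G"
    using adj adj_in_verts[OF adj(1)] adj_in_verts[OF adj(3)]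
    by (simp add: vpath_def vwalk_def)
  moreover have "repetition (map \<phi> [a, b, a', b'])"
    unfolding repetition_def
    using assms(5,6) by (intro exI[of _ 2]) (auto simp: less_2_cases_iff)
  ultimately show False using nonrep by (auto simp: nonrepetitive_def)
qed

lemma complete_multipartite_colours:
  assumes "complete_multipartite G" and nonrep: "nonrepetitive G \<phi>"
  shows "card (verts G) - independence_number G + 1 \<le> card (\<phi> ` verts G)"
proof -
  obtain P where g: "graph G" and P: "P \<noteq> {}" "partition_on (verts G) P"
    and "\<forall>u\<in>verts G. \<forall>v\<in>verts G. u \<rightarrow>\<^bsub>G\<^esub> v \<longleftrightarrow> \<not> (\<exists>V\<in>P. u \<in> V \<and> v \<in> V)"
    using assms(1) unfolding complete_multipartite_def by (elim conjE exE)
  then have adj: "u \<rightarrow>\<^bsub>G\<^esub> v \<longleftrightarrow> \<not> (\<exists>V\<in>P. u \<in> V \<and> v \<in> V)"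
    if "u \<in> verts G" "v \<in> verts G" for u v
    using that by simp
  interpret graph G by fact
  have sub: "V \<subseteq> verts G" if "V \<in> P" for V
    using P(2) that by (auto simp: partition_on_def)
  have uniq: "V = W" if "V \<in> P" "W \<in> P" "x \<in> V" "x \<in> W" for V W x
    using P(2) that by (auto simp: partition_on_def dest: disjointD)
  have cross: "u \<rightarrow>\<^bsub>G\<^esub> v" if "V \<in> P" "u \<in> V" "v \<in> verts G - V" for V u v
  proof -
    have "\<not> (\<exists>W\<in>P. u \<in> W \<and> v \<in> W)"
      using that(3) uniq[OF that(1) _ that(2)] by auto
    then show ?thesis
      using adj[of u v] sub[OF that(1)] that(2,3) by auto
  qed
  have cross': "v \<rightarrow>\<^bsub>G\<^esub> u" if "V \<in> P" "u \<in> V" "v \<in> verts G - V" for V u v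
    by (rule arcs_ends_symmetric[OF sym_arcs cross[OF that]])
  note neq = nonrepetitive_adjacent[OF loopfree_digraph_axioms nonrep]
  have same_part: "\<exists>V\<in>P. u \<in> V \<and> v \<in> V" if "u \<in> verts G" "v \<in> verts G" "\<phi> u = \<phi> v" for u v
    using adj[OF that(1,2)] neq[of u v] that(3) by auto
  have "\<exists>V\<in>P. inj_on \<phi> (verts G - V)"
  proof (cases "inj_on \<phi> (verts G)")
    case True
    \<comment> \<open>With all colours distinct any part serves, and \<open>P\<close> is
      nonempty.\<close>
    then show ?thesis using P(1) by (meson Diff_subset ex_in_conv inj_on_subset)
  next
    case False
    then obtain a a' where a: "a \<in> verts G" "a' \<in> verts G" "\<phi> a = \<phi> a'" "a \<noteq> a'"
      by (auto simp: inj_on_def)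
    then obtain V where V: "V \<in> P" "a \<in> V" "a' \<in> V" using same_part by blast
    \<comment> \<open>Every vertex outside \<open>V\<close> is adjacent to both \<open>a\<close> and
      \<open>a'\<close>, so any equally coloured pair outside \<open>V\<close> completes the
      forbidden alternating path.\<close>
    have "inj_on \<phi> (verts G - V)"
    proof (rule inj_onI, rule ccontr)
      fix b b' assume b: "b \<in> verts G - V" "b' \<in> verts G - V" "\<phi> b = \<phi> b'" "b \<noteq> b'"
      show False
        by (rule nonrepetitive_no_crossing_pairs[OF g nonrep a(4) b(4) a(3) b(3)])
          (use V b(1,2) in \<open>auto intro: cross[OF V(1)] cross'[OF V(1)]\<close>)
    qed
    then show ?thesis using V(1) by blast
  qed
  then obtain V where V: "V \<in> P" "inj_on \<phi> (verts G - V)" by blast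
  have finV: "finite V" using sub[OF V(1)] finite_verts finite_subset by blast
  have "V \<noteq> {}" using P(2) V(1) by (auto simp: partition_on_def)
  then have 1: "1 \<le> card (\<phi> ` V)"
    using finV by (simp add: Suc_le_eq card_gt_0_iff)
  \<comment> \<open>All pairs across the boundary of \<open>V\<close> are adjacent, and adjacent
    vertices differ in colour.\<close>
  have disj: "\<phi> ` (verts G - V) \<inter> \<phi> ` V = {}"
    using cross[OF V(1)] neq by fastforce
  have "independent_set G V"
    using sub[OF V(1)] V(1) by (auto simp: independent_set_def adj subset_iff)
  then have "card V \<le> independence_number G"
    by (rule card_le_independence_number[OF finite_verts])
  \<comment> \<open>The nonempty \<open>V\<close> contributes the summand 1; replacing
    \<open>card V\<close> by the independence number, which is at least as large, can only lower the
    left side.\<close>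
  then have "card (verts G) - independence_number G + 1 \<le> card (verts G - V) + card (\<phi> ` V)"
    using 1 sub[OF V(1)] finV by (simp add: card_Diff_subset)
  also have "\<dots> = card (\<phi> ` (verts G - V) \<union> \<phi> ` V)"
    using disj finV V(2) by (simp add: card_Un_disjoint card_image)
  also have "\<phi> ` (verts G - V) \<union> \<phi> ` V = \<phi> ` verts G"
    using sub[OF V(1)] by blast
  finally show ?thesis .
qed

theorem theorem2p2:
  fixes G :: "('a,'b) pre_digraph" and n :: nat
  assumes "graph G" and "card (verts G) = n"
  shows "thue_chromatic_number G \<le> thue_choice_number G \<and>
         thue_choice_number G \<le> n - independence_number G + 1 \<and>
         (complete_multipartite G \<longrightarrow>
            thue_chromatic_number G = thue_choice_number G \<and>
            thue_choice_number G = n - independence_number G + 1)"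
proof -
  interpret graph G by fact
  have le: "thue_chromatic_number G \<le> thue_choice_number G"
    by (rule thue_chromatic_le_choice_number[OF finite_verts])
  have ub: "thue_choice_number G \<le> n - independence_number G + 1"
    using thue_choice_number_le[OF thue_choosable_independence_number[OF finite_verts]] assms(2)
    by simp
  have lb: "n - independence_number G + 1 \<le> thue_chromatic_number G" if "complete_multipartite G"
  proof -
    obtain \<phi> :: "'a \<Rightarrow> nat"
      where "nonrepetitive G \<phi>" "card (\<phi> ` verts G) = thue_chromatic_number G"
      using obtain_optimal_nonrepetitive[OF finite_verts] .
    then show ?thesis
      using complete_multipartite_colours[OF that] assms(2) by fastforce
  qed
  \<comment> \<open>In the multipartite case \<open>lb\<close> closes the cycle of inequalities, so
    all three quantities coincide.\<close>
  show ?thesis using le ub lb by fastforce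
qed

end
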